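(* Let $V$ be a value quantale. The functor $(-)_{\succ}:\mathbf{rFil_V}\to\mathbf{rRFil_V}$, $(X,\mathcal{F})\mapsto(X,\mathcal{F}_{\succ})$, $f\mapsto f$, restricts to a functor $(-)_{\succ}:\mathbf{rCFil_V}\to\mathbf{rCRFil_V}$. This functor is left adjoint to the inclusion functor $\mathbf{rCRFil_V}\to\mathbf{rCFil_V}$.
   Context: A value quantale is a pair $(V,+)$ where $V$ is a complete lattice with bottom $0$ and top $\infty$, and $+$ is an associative commutative binary operation on $V$ such that $x+0=x$, $x=\bigwedge\{y\in V\mid y\succ x\}$, $x+\bigwedge S=\bigwedge\{x+s\mid s\in S\}$, and $a\wedge b\succ 0$ whenever $a\succ0$ and $b\succ0$ (for all $x,a,b\in V$, $S\subseteq V$). Here $a\succ b$ ("$a$ is well above $b$") means: for every $S\subseteq V$ with $b\ge\bigwedge S$ there is $s\in S$ with $a\ge s$. Writing "$\varepsilon\succ0$" presumes $\varepsilon\in V$. A $V$-space is a set $X$ with a function $d:X\times X\to V$ with $d(x,x)=0$ and $d(x,z)\le d(x,y)+d(y,z)$ for all $x,y,z\in X$. It has uniformly vanishing asymmetry if for all $\varepsilon\succ0$ there is $\delta\succ0$ such that $d(y,x)\le\delta$ implies $d(x,y)\le\varepsilon$, for all $x,y\in X$. A function $f:X\to Y$ between $V$-spaces is uniformly continuous if for all $\varepsilon\succ0$ there is $\delta\succ0$ such that $d(x_1,x_2)\le\delta$ implies $d(f(x_1),f(x_2))\le\varepsilon$. For $\varepsilon\succ0$, $x\in X$, $S\subseteq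 X$ put $\mathbf{B}_{\varepsilon}(x)=\{y\in X\mid d(x,y)\le\varepsilon\}$ and $\mathbf{B}_{\varepsilon}(S)=\bigcup_{s\in S}\mathbf{B}_{\varepsilon}(s)$. A filter on $X$ is a non-empty collection $\mathcal{F}\subseteq\mathcal{P}(X)$ closed under supersets and binary intersections ($\emptyset\in\mathcal{F}$ is allowed, so $\mathcal{P}(X)$ is a filter). A filter $\mathcal{F}$ is Cauchy if for all $\varepsilon\succ0$ there is $x\in X$ with $\mathbf{B}_{\varepsilon}(x)\in\mathcal{F}$. It is round if for all $F\in\mathcal{F}$ there is $\varepsilon\succ0$ such that for all $x\in X$, $\mathbf{B}_{\varepsilon}(x)\in\mathcal{F}$ implies $\mathbf{B}_{\varepsilon}(x)\subseteq F$. For a filter $\mathcal{F}$, $\mathcal{F}_{\succ}$ denotes the filter generated by (the least filter containing) the filter base $\{\mathbf{B}_{\varepsilon}(F)\mid F\in\mathcal{F},\ \varepsilon\succ0\}$. $\mathbf{Fil_V}$ is the category whose objects are pairs $(X,\mathcal{F})$ with $X$ a $V$-space with uniformly vanishing asymmetry and $\mathcal{F}$ a filter on $X$; a morphism $(X,\mathcal{F})\to(Y,\mathcal{G})$ is a uniformly continuous function $f:X\to Y$ with $f(\mathcal{F})\supseteq\mathcal{G}$, where $f(\mathcal{F})=\{S\subseteq Y\mid f^{-1}(S)\in\mathcal{F}\}$. An object $(X,\mathcal{F})$ is restricted if $\mathcal{F}\neq\mathcal{P}(X)$ whenever $X\neq\emptyset$. $\mathbf{rFil_V}$, $\mathbf{rRFil_V}$,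 $\mathbf{rCFil_V}$ and $\mathbf{rCRFil_V}$ are the full subcategories of $\mathbf{Fil_V}$ spanned by the restricted objects $(X,\mathcal{F})$ with, respectively, $\mathcal{F}$ arbitrary, $\mathcal{F}$ round, $\mathcal{F}$ Cauchy, and $\mathcal{F}$ both Cauchy and round.
   Formalization: The formal statement assumes that 0 ≠ ∞ in V; for the one-element value quantale no ε ≻ 0 exists, no filter is round, and the claimed functors into the then empty categories rRFil_V and rCRFil_V cannot exist. *)

theory Defs
  imports Main "HOL-Library.FuncSet"
begin

section \<open>Value quantales\<close>

definition (in complete_lattice) well_above :: "'a \<Rightarrow> 'a \<Rightarrow> bool"  (infix \<open>\<succ>\<close> 50)
  where "a \<succ> b \<longleftrightarrow> (\<forall>S. Inf S \<le> b \<longrightarrow> (\<exists>s\<in>S. s \<le> a))"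

text \<open>
  As in the paper, the one-element lattice is not excluded by the axioms. It is a degenerate case
  in which no element is well above \<open>0\<close>.
\<close>

class value_quantale = complete_lattice + comm_monoid_add +
  assumes zero_eq_bot: "0 = bot"
    and Inf_well_above: "x = Inf {y. y \<succ> x}"
    and add_Inf_distrib: "x + Inf S = Inf {x + s | s. s \<in> S}"
    and inf_well_above_zero: "a \<succ> 0 \<Longrightarrow> b \<succ> 0 \<Longrightarrow> inf a b \<succ> 0"


section \<open>V-spaces\<close>

text \<open>
  The underlying sets of spaces are the subsets of an arbitrary type \<open>'a\<close>, which plays the role of
  the universe. A distance is a function on \<open>X \<times> X\<close> only: it takes the value \<^const>\<open>undefined\<close>
  elsewhere, so that equality of spaces is the intended one.
\<close>

record ('a, 'v) space =
  points :: "'a set"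
  distance :: "'a \<times> 'a \<Rightarrow> 'v"

definition is_vspace :: "('a, 'v::value_quantale) space \<Rightarrow> bool" where
  "is_vspace X \<longleftrightarrow>
     distance X \<in> points X \<times> points X \<rightarrow>\<^sub>E UNIV \<and>
     (\<forall>x\<in>points X. distance X (x, x) = 0) \<and>
     (\<forall>x\<in>points X. \<forall>y\<in>points X. \<forall>z\<in>points X.
        distance X (x, z) \<le> distance X (x, y) + distance X (y, z))"

definition uniformly_vanishing_asymmetry :: "('a, 'v::value_quantale) space \<Rightarrow> bool" where
  "uniformly_vanishing_asymmetry X \<longleftrightarrow>
     (\<forall>\<epsilon>. \<epsilon> \<succ> 0 \<longrightarrow> (\<exists>\<delta>. \<delta> \<succ> 0 \<and>
        (\<forall>x\<in>points X. \<forall>y\<in>points X. distance X (y, x) \<le> \<delta> \<longrightarrow> distance X (x, y) \<le> \<epsilon>)))"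

definition unif_continuous ::
    "('a, 'v::value_quantale) space \<Rightarrow> ('b, 'v) space \<Rightarrow> ('a \<Rightarrow> 'b) \<Rightarrow> bool" where
  "unif_continuous X Y f \<longleftrightarrow>
     (\<forall>\<epsilon>. \<epsilon> \<succ> 0 \<longrightarrow> (\<exists>\<delta>. \<delta> \<succ> 0 \<and>
        (\<forall>x\<^sub>1\<in>points X. \<forall>x\<^sub>2\<in>points X.
           distance X (x\<^sub>1, x\<^sub>2) \<le> \<delta> \<longrightarrow> distance Y (f x\<^sub>1, f x\<^sub>2) \<le> \<epsilon>)))"

definition pt_ball :: "('a, 'v::value_quantale) space \<Rightarrow> 'v \<Rightarrow> 'a \<Rightarrow> 'a set" where
  "pt_ball X \<epsilon> x = {y \<in> points X. distance X (x, y) \<le> \<epsilon>}"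

definition set_ball :: "('a, 'v::value_quantale) space \<Rightarrow> 'v \<Rightarrow> 'a set \<Rightarrow> 'a set" where
  "set_ball X \<epsilon> S = (\<Union>s\<in>S. pt_ball X \<epsilon> s)"


section \<open>Filters\<close>

text \<open>
  Filters are families of subsets of the carrier, and the improper filter \<^term>\<open>Pow X\<close> is allowed.
\<close>

definition is_filter_on :: "'a set \<Rightarrow> 'a set set \<Rightarrow> bool" where
  "is_filter_on X \<F> \<longleftrightarrow>
     \<F> \<subseteq> Pow X \<and> \<F> \<noteq> {} \<and>
     (\<forall>A\<in>\<F>. \<forall>B. A \<subseteq> B \<and> B \<subseteq> X \<longrightarrow> B \<in> \<F>) \<and>
     (\<forall>A\<in>\<F>. \<forall>B\<in>\<F>. A \<inter> B \<in> \<F>)"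

definition generated_filter :: "'a set \<Rightarrow> 'a set set \<Rightarrow> 'a set set" where
  "generated_filter X \<B> = \<Inter>{\<G>. is_filter_on X \<G> \<and> \<B> \<subseteq> \<G>}"

definition image_filter :: "'a set \<Rightarrow> 'b set \<Rightarrow> ('a \<Rightarrow> 'b) \<Rightarrow> 'a set set \<Rightarrow> 'b set set" where
  "image_filter X Y f \<F> = {S. S \<subseteq> Y \<and> f -` S \<inter> X \<in> \<F>}"

definition cauchy_filter :: "('a, 'v::value_quantale) space \<Rightarrow> 'a set set \<Rightarrow> bool" where
  "cauchy_filter X \<F> \<longleftrightarrow> (\<forall>\<epsilon>. \<epsilon> \<succ> 0 \<longrightarrow> (\<exists>x\<in>points X. pt_ball X \<epsilon> x \<in> \<F>))"

definition round_filter :: "('a, 'v::value_quantale) space \<Rightarrow> 'a set set \<Rightarrow> bool" where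
  "round_filter X \<F> \<longleftrightarrow>
     (\<forall>A\<in>\<F>. \<exists>\<epsilon>. \<epsilon> \<succ> 0 \<and> (\<forall>x\<in>points X. pt_ball X \<epsilon> x \<in> \<F> \<longrightarrow> pt_ball X \<epsilon> x \<subseteq> A))"

definition succ_filter :: "('a, 'v::value_quantale) space \<Rightarrow> 'a set set \<Rightarrow> 'a set set" where
  "succ_filter X \<F> = generated_filter (points X) {set_ball X \<epsilon> A | A \<epsilon>. A \<in> \<F> \<and> \<epsilon> \<succ> 0}"


section \<open>Categories, functors and adjunctions\<close>

text \<open>
  Hom-sets of different pairs of objects need not be disjoint, hence composition, identities and the
  arrow part of a functor take the objects involved as arguments: \<^term>\<open>Comp \<C> A B C g f\<close> is
  \<open>g \<circ> f\<close> for \<open>f : A \<rightarrow> B\<close> and \<open>g : B \<rightarrow> C\<close>.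
\<close>

record ('o, 'm) cat =
  Obj :: "'o set"
  Hom :: "'o \<Rightarrow> 'o \<Rightarrow> 'm set"
  Ident :: "'o \<Rightarrow> 'm"
  Comp :: "'o \<Rightarrow> 'o \<Rightarrow> 'o \<Rightarrow> 'm \<Rightarrow> 'm \<Rightarrow> 'm"

definition is_category :: "('o, 'm) cat \<Rightarrow> bool" where
  "is_category \<C> \<longleftrightarrow>
     (\<forall>A\<in>Obj \<C>. Ident \<C> A \<in> Hom \<C> A A) \<and>
     (\<forall>A\<in>Obj \<C>. \<forall>B\<in>Obj \<C>. \<forall>C\<in>Obj \<C>. \<forall>f\<in>Hom \<C> A B. \<forall>g\<in>Hom \<C> B C.
        Comp \<C> A B C g f \<in> Hom \<C> A C) \<and>
     (\<forall>A\<in>Obj \<C>. \<forall>B\<in>Obj \<C>. \<forall>f\<in>Hom \<C> A B.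
        Comp \<C> A A B f (Ident \<C> A) = f \<and> Comp \<C> A B B (Ident \<C> B) f = f) \<and>
     (\<forall>A\<in>Obj \<C>. \<forall>B\<in>Obj \<C>. \<forall>C\<in>Obj \<C>. \<forall>D\<in>Obj \<C>.
        \<forall>f\<in>Hom \<C> A B. \<forall>g\<in>Hom \<C> B C. \<forall>h\<in>Hom \<C> C D.
        Comp \<C> A C D h (Comp \<C> A B C g f) = Comp \<C> A B D (Comp \<C> B C D h g) f)"

definition full_subcategory :: "('o, 'm) cat \<Rightarrow> ('o \<Rightarrow> bool) \<Rightarrow> ('o, 'm) cat" where
  "full_subcategory \<C> P = \<C>\<lparr>Obj := {A \<in> Obj \<C>. P A}\<rparr>"

record ('o, 'm, 'p, 'n) cat_functor =
  onObj :: "'o \<Rightarrow> 'p"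
  onArr :: "'o \<Rightarrow> 'o \<Rightarrow> 'm \<Rightarrow> 'n"

definition is_functor ::
    "('o, 'm) cat \<Rightarrow> ('p, 'n) cat \<Rightarrow> ('o, 'm, 'p, 'n) cat_functor \<Rightarrow> bool" where
  "is_functor \<C> \<D> F \<longleftrightarrow>
     is_category \<C> \<and> is_category \<D> \<and>
     (\<forall>A\<in>Obj \<C>. onObj F A \<in> Obj \<D>) \<and>
     (\<forall>A\<in>Obj \<C>. \<forall>B\<in>Obj \<C>. \<forall>f\<in>Hom \<C> A B.
        onArr F A B f \<in> Hom \<D> (onObj F A) (onObj F B)) \<and>
     (\<forall>A\<in>Obj \<C>. onArr F A A (Ident \<C> A) = Ident \<D> (onObj F A)) \<and>
     (\<forall>A\<in>Obj \<C>. \<forall>B\<in>Obj \<C>. \<forall>C\<in>Obj \<C>. \<forall>f\<in>Hom \<C> A B. \<forall>g\<in>Hom \<C> B C.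
        onArr F A C (Comp \<C> A B C g f) =
        Comp \<D> (onObj F A) (onObj F B) (onObj F C) (onArr F B C g) (onArr F A B f))"

definition inclusion_functor :: "('o, 'm, 'o, 'm) cat_functor" where
  "inclusion_functor = \<lparr>onObj = (\<lambda>A. A), onArr = (\<lambda>A B f. f)\<rparr>"

text \<open>
  \<open>F : \<C> \<rightarrow> \<D>\<close> is left adjoint to \<open>G : \<D> \<rightarrow> \<C>\<close> if there are bijections
  \<open>\<D>(F A, B) \<cong> \<C>(A, G B)\<close> natural in \<open>A\<close> and \<open>B\<close>.
\<close>

definition is_left_adjoint ::
    "('o, 'm) cat \<Rightarrow> ('p, 'n) cat \<Rightarrow> ('o, 'm, 'p, 'n) cat_functor \<Rightarrow> ('p, 'n, 'o, 'm) cat_functor \<Rightarrow> bool"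
  where
  "is_left_adjoint \<C> \<D> F G \<longleftrightarrow>
     is_functor \<C> \<D> F \<and> is_functor \<D> \<C> G \<and>
     (\<exists>\<phi>.
        (\<forall>A\<in>Obj \<C>. \<forall>B\<in>Obj \<D>.
           bij_betw (\<phi> A B) (Hom \<D> (onObj F A) B) (Hom \<C> A (onObj G B))) \<and>
        (\<forall>A\<in>Obj \<C>. \<forall>A'\<in>Obj \<C>. \<forall>B\<in>Obj \<D>. \<forall>B'\<in>Obj \<D>.
           \<forall>h\<in>Hom \<C> A' A. \<forall>k\<in>Hom \<D> B B'. \<forall>g\<in>Hom \<D> (onObj F A) B.
           \<phi> A' B' (Comp \<D> (onObj F A') B B' k
                       (Comp \<D> (onObj F A') (onObj F A) B g (onArr F A' A h))) =
           Comp \<C> A' (onObj G B) (onObj G B') (onArr G B B' k)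
             (Comp \<C> A' A (onObj G B) (\<phi> A B g) h)))"


section \<open>The categories of V-spaces with a filter\<close>

type_synonym ('a, 'v) fil_obj = "('a, 'v) space \<times> 'a set set"
type_synonym ('a, 'v) fil_cat = "(('a, 'v) fil_obj, 'a \<Rightarrow> 'a) cat"
type_synonym ('a, 'v) fil_endofunctor =
  "(('a, 'v) fil_obj, 'a \<Rightarrow> 'a, ('a, 'v) fil_obj, 'a \<Rightarrow> 'a) cat_functor"

definition Fil :: "('a, 'v::value_quantale) fil_cat" where
  "Fil = \<lparr>
     Obj = {(X, \<F>). is_vspace X \<and> uniformly_vanishing_asymmetry X \<and> is_filter_on (points X) \<F>},
     Hom = (\<lambda>(X, \<F>) (Y, \<G>). {f \<in> points X \<rightarrow>\<^sub>E points Y.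
              unif_continuous X Y f \<and> \<G> \<subseteq> image_filter (points X) (points Y) f \<F>}),
     Ident = (\<lambda>(X, \<F>). \<lambda>x\<in>points X. x),
     Comp = (\<lambda>(X, \<F>) (Y, \<G>) (Z, \<H>) g f. compose (points X) g f)\<rparr>"

definition restricted :: "('a, 'v::value_quantale) fil_obj \<Rightarrow> bool" where
  "restricted = (\<lambda>(X, \<F>). points X \<noteq> {} \<longrightarrow> \<F> \<noteq> Pow (points X))"

definition rFil :: "('a, 'v::value_quantale) fil_cat" where
  "rFil = full_subcategory Fil restricted"

definition rRFil :: "('a, 'v::value_quantale) fil_cat" where
  "rRFil = full_subcategory Fil (\<lambda>(X, \<F>). restricted (X, \<F>) \<and> round_filter X \<F>)"

definition rCFil :: "('a, 'v::value_quantale) fil_cat" where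
  "rCFil = full_subcategory Fil (\<lambda>(X, \<F>). restricted (X, \<F>) \<and> cauchy_filter X \<F>)"

definition rCRFil :: "('a, 'v::value_quantale) fil_cat" where
  "rCRFil = full_subcategory Fil
     (\<lambda>(X, \<F>). restricted (X, \<F>) \<and> cauchy_filter X \<F> \<and> round_filter X \<F>)"

definition succ_functor :: "('a, 'v::value_quantale) fil_endofunctor" where
  "succ_functor = \<lparr>onObj = (\<lambda>(X, \<F>). (X, succ_filter X \<F>)), onArr = (\<lambda>A B f. f)\<rparr>"

end

theory Submission
  imports Defs
begin

text \<open>
  Everything rests on halving: below each \<open>\<epsilon> \<succ> 0\<close> there is a sum \<open>\<delta> + \<delta>\<close> with \<open>\<delta> \<succ> 0\<close>
  (\<open>well_above_zero_halving\<close>), so by the triangle inequality a \<open>\<delta>\<close>-neighbourhood of a \<open>\<delta>\<close>-ball stays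
  in the concentric \<open>\<epsilon>\<close>-ball. A member of \<open>\<F>\<^sub>\<succ>\<close> is a set that contains a uniform neighbourhood of a
  member of \<open>\<F>\<close>, whence \<open>\<F>\<^sub>\<succ> \<subseteq> \<F>\<close>, so that \<open>\<F>\<^sub>\<succ>\<close> is again restricted; halving shows that \<open>(-)\<^sub>\<succ>\<close>
  preserves the Cauchy property.

  For roundness (\<open>round_succ_filter\<close>), a small ball in \<open>\<F>\<^sub>\<succ>\<close> belongs to \<open>\<F>\<close>, so it meets each
  \<open>A \<in> \<F>\<close> because \<open>\<F>\<close> is proper. Being small, it lies in the prescribed neighbourhood of \<open>A\<close>; it is
  here that the asymmetry has to vanish uniformly, since the distance from the common point back to
  the centre of the ball must be small as well.

  A uniformly continuous map pulls a neighbourhood of \<open>B\<close> back to one that contains a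
  neighbourhood of the preimage of \<open>B\<close>, so morphisms \<open>\<F> \<rightarrow> \<G>\<close> are also morphisms
  \<open>\<F>\<^sub>\<succ> \<rightarrow> \<G>\<^sub>\<succ>\<close>, and \<open>(-)\<^sub>\<succ>\<close> is a functor. When \<open>\<G>\<close> is Cauchy and round, \<open>\<G> \<subseteq> \<G>\<^sub>\<succ>\<close>
  (\<open>cauchy_round_subset_succ_filter\<close>). Consequently, for such \<open>\<G>\<close>, the morphisms \<open>\<F> \<rightarrow> \<G>\<close> and
  \<open>\<F>\<^sub>\<succ> \<rightarrow> \<G>\<close> are the same functions (\<open>Hom_Fil_succ_filter_eq\<close>), and the identity is the
  adjunction bijection.
\<close>

section \<open>Halving in a value quantale\<close>

text \<open>
  This guarantees that some \<open>\<epsilon> \<succ> 0\<close> exists, without which the base that generates \<open>\<F>\<^sub>\<succ>\<close> would be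
  empty and no filter could be round.
\<close>

lemma top_well_above_zero:
  assumes "(0::'v::value_quantale) \<noteq> top"
  shows "(top::'v) \<succ> 0"
  unfolding well_above_def
proof (intro allI impI)
  fix S :: "'v set"
  assume "Inf S \<le> 0"
  then have "S \<noteq> {}"
    using assms by (auto simp: zero_eq_bot bot_unique)
  then show "\<exists>s\<in>S. s \<le> top"
    by auto
qed

text \<open>Distributing addition over the meet of a comparable pair gives monotonicity.\<close>

lemma quantale_add_left_mono:
  fixes x y z :: "'v::value_quantale"
  assumes "x \<le> y"
  shows "z + x \<le> z + y"
proof -
  have "z + x = z + Inf {x, y}"
    using assms by (simp add: inf_absorb1)
  also have "\<dots> = Inf {z + s | s. s \<in> {x, y}}"
    by (rule add_Inf_distrib)
  also have "\<dots> \<le> z + y"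
    by (rule Inf_lower) auto
  finally show ?thesis .
qed

lemma quantale_add_mono:
  fixes a b c d :: "'v::value_quantale"
  assumes "a \<le> c" "b \<le> d"
  shows "a + b \<le> c + d"
  using quantale_add_left_mono[OF assms(1), of b] quantale_add_left_mono[OF assms(2), of c]
  by (simp add: add.commute)

text \<open>
  Since \<open>0\<close> is the meet of the elements well above it, \<open>0 = 0 + 0\<close> is the meet of their pairwise
  sums, so one of these sums lies below \<open>\<epsilon>\<close>.
\<close>

lemma well_above_zero_halving:
  fixes \<epsilon> :: "'v::value_quantale"
  assumes "\<epsilon> \<succ> 0"
  obtains \<delta> where "\<delta> \<succ> 0" "\<delta> + \<delta> \<le> \<epsilon>"
proof -
  let ?P = "{y::'v. y \<succ> 0}"
  let ?S = "{s + t | s t. s \<in> ?P \<and> t \<in> ?P}"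
  have P: "Inf ?P = 0"
    using Inf_well_above[of "0::'v"] by simp
  have "Inf ?S \<le> s" if "s \<in> ?P" for s
  proof -
    have "Inf ?S \<le> Inf {s + t | t. t \<in> ?P}"
      using that by (intro Inf_superset_mono) auto
    also have "\<dots> = s"
      using add_Inf_distrib[of s ?P] P by simp
    finally show ?thesis .
  qed
  then have "Inf ?S \<le> 0"
    using Inf_greatest[of ?P "Inf ?S"] P by simp
  then obtain s t where st: "s \<succ> 0" "t \<succ> 0" "s + t \<le> \<epsilon>"
    using assms unfolding well_above_def[of \<epsilon>] by blast
  show thesis
  proof
    show "inf s t \<succ> 0"
      using st by (intro inf_well_above_zero)
    show "inf s t + inf s t \<le> \<epsilon>"
      using st(3) by (meson inf_le1 inf_le2 order_trans quantale_add_mono)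
  qed
qed

section \<open>Balls\<close>

lemma set_ball_iff:
  "z \<in> set_ball X \<epsilon> A \<longleftrightarrow> z \<in> points X \<and> (\<exists>y\<in>A. distance X (y, z) \<le> \<epsilon>)"
  by (auto simp: set_ball_def pt_ball_def)

lemma set_ball_subset_points: "set_ball X \<epsilon> A \<subseteq> points X"
  by (auto simp: set_ball_iff)

lemma subset_set_ball:
  assumes "is_vspace X" "A \<subseteq> points X"
  shows "A \<subseteq> set_ball X \<epsilon> A"
  using assms by (force simp: set_ball_iff is_vspace_def zero_eq_bot)

lemma set_ball_pt_ball_subset:
  assumes "is_vspace X" "x \<in> points X" "\<delta> + \<delta>' \<le> \<epsilon>"
  shows "set_ball X \<delta>' (pt_ball X \<delta> x) \<subseteq> pt_ball X \<epsilon> x"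
proof
  fix z
  assume "z \<in> set_ball X \<delta>' (pt_ball X \<delta> x)"
  then obtain y where yz: "y \<in> points X" "z \<in> points X"
    and d: "distance X (x, y) \<le> \<delta>" "distance X (y, z) \<le> \<delta>'"
    by (auto simp: set_ball_iff pt_ball_def)
  have "distance X (x, z) \<le> distance X (x, y) + distance X (y, z)"
    using assms(1,2) yz by (simp add: is_vspace_def)
  also have "\<dots> \<le> \<delta> + \<delta>'"
    using d by (rule quantale_add_mono)
  finally show "z \<in> pt_ball X \<epsilon> x"
    using assms(3) yz by (auto simp: pt_ball_def)
qed

section \<open>The filter of uniform neighbourhoods\<close>

lemma is_filter_onI:
  assumes "\<And>A B. A \<in> \<F> \<Longrightarrow> B \<in> \<F> \<Longrightarrow> A \<inter> B \<in> \<F>"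
    and "\<And>A B. A \<in> \<F> \<Longrightarrow> A \<subseteq> B \<Longrightarrow> B \<subseteq> X \<Longrightarrow> B \<in> \<F>"
    and "\<F> \<noteq> {}" "\<F> \<subseteq> Pow X"
  shows "is_filter_on X \<F>"
  using assms by (simp add: is_filter_on_def)

lemma filter_supersetD:
  assumes "is_filter_on X \<F>" "A \<in> \<F>" "A \<subseteq> B" "B \<subseteq> X"
  shows "B \<in> \<F>"
  using assms by (simp add: is_filter_on_def)

lemma filter_IntD:
  assumes "is_filter_on X \<F>" "A \<in> \<F>" "B \<in> \<F>"
  shows "A \<inter> B \<in> \<F>"
  using assms by (simp add: is_filter_on_def)

lemma filter_subsetD:
  assumes "is_filter_on X \<F>" "A \<in> \<F>"
  shows "A \<subseteq> X"
  using assms by (auto simp: is_filter_on_def)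

lemma filter_improper_iff:
  assumes "is_filter_on X \<F>"
  shows "\<F> = Pow X \<longleftrightarrow> {} \<in> \<F>"
  using filter_supersetD[OF assms, of "{}"] filter_subsetD[OF assms] by auto

lemma generated_filter_base:
  assumes "\<B> \<subseteq> Pow X" "\<B> \<noteq> {}"
    and dir: "\<And>A B. A \<in> \<B> \<Longrightarrow> B \<in> \<B> \<Longrightarrow> \<exists>C\<in>\<B>. C \<subseteq> A \<inter> B"
  shows "is_filter_on X (generated_filter X \<B>)"
    and "generated_filter X \<B> = {G. G \<subseteq> X \<and> (\<exists>B\<in>\<B>. B \<subseteq> G)}"
proof -
  let ?U = "{G. G \<subseteq> X \<and> (\<exists>B\<in>\<B>. B \<subseteq> G)}"
  have "\<exists>C\<in>\<B>. C \<subseteq> G \<inter> H" if "G \<in> ?U" "H \<in> ?U" for G H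
  proof -
    from that obtain A B where AB: "A \<in> \<B>" "A \<subseteq> G" "B \<in> \<B>" "B \<subseteq> H"
      by auto
    then obtain C where "C \<in> \<B>" "C \<subseteq> A \<inter> B"
      using dir by metis
    with AB show ?thesis
      by (intro bexI[of _ C]) auto
  qed
  then have "G \<inter> H \<in> ?U" if "G \<in> ?U" "H \<in> ?U" for G H
    using that by auto
  moreover have "H \<in> ?U" if "G \<in> ?U" "G \<subseteq> H" "H \<subseteq> X" for G H
  proof -
    from that(1) obtain B where "B \<in> \<B>" "B \<subseteq> G"
      by auto
    with that(2,3) show ?thesis
      by (auto intro!: bexI[of _ B])
  qed
  moreover have "?U \<noteq> {}"
    using assms(1,2) by auto
  moreover have "?U \<subseteq> Pow X"
    by auto
  ultimately have U: "is_filter_on X ?U"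
    by (rule is_filter_onI)
  have "\<B> \<subseteq> ?U"
    using assms(1) by auto
  with U have "generated_filter X \<B> \<subseteq> ?U"
    unfolding generated_filter_def by (intro Inter_lower) simp
  moreover have "?U \<subseteq> \<G>" if "is_filter_on X \<G>" "\<B> \<subseteq> \<G>" for \<G>
    using filter_supersetD[OF that(1)] that(2) by auto
  then have "?U \<subseteq> generated_filter X \<B>"
    unfolding generated_filter_def by (intro Inter_greatest) simp
  ultimately show "generated_filter X \<B> = ?U"
    by (rule equalityI)
  with U show "is_filter_on X (generated_filter X \<B>)"
    by simp
qed

lemma succ_filter_is_filter_on_and_eq:
  fixes X :: "('a, 'v::value_quantale) space"
  assumes "(0::'v) \<noteq> top" and F: "is_filter_on (points X) \<F>"
  shows is_filter_on_succ_filter: "is_filter_on (points X) (succ_filter X \<F>)"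
    and succ_filter_eq: "succ_filter X \<F> =
      {G. G \<subseteq> points X \<and> (\<exists>A\<in>\<F>. \<exists>\<epsilon>. \<epsilon> \<succ> 0 \<and> set_ball X \<epsilon> A \<subseteq> G)}"
proof -
  let ?B = "{set_ball X \<epsilon> A | A \<epsilon>. A \<in> \<F> \<and> \<epsilon> \<succ> 0}"
  have sub: "?B \<subseteq> Pow (points X)"
    by (auto simp: set_ball_iff)
  have ne: "?B \<noteq> {}"
    using F top_well_above_zero[OF assms(1)] by (auto simp: is_filter_on_def)
  have dir: "\<exists>C\<in>?B. C \<subseteq> P \<inter> Q" if "P \<in> ?B" "Q \<in> ?B" for P Q
  proof -
    from that obtain A \<epsilon> B \<delta> where *: "P = set_ball X \<epsilon> A" "A \<in> \<F>" "\<epsilon> \<succ> 0"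
      "Q = set_ball X \<delta> B" "B \<in> \<F>" "\<delta> \<succ> 0"
      by blast
    have "set_ball X (inf \<epsilon> \<delta>) (A \<inter> B) \<in> ?B"
      using * filter_IntD[OF F, of A B] inf_well_above_zero[of \<epsilon> \<delta>] by blast
    moreover have "set_ball X (inf \<epsilon> \<delta>) (A \<inter> B) \<subseteq> P \<inter> Q"
      using * by (auto simp: set_ball_iff)
    ultimately show ?thesis
      by blast
  qed
  show "is_filter_on (points X) (succ_filter X \<F>)"
    unfolding succ_filter_def by (rule generated_filter_base(1)[OF sub ne dir])
  have "succ_filter X \<F> = {G. G \<subseteq> points X \<and> (\<exists>B\<in>?B. B \<subseteq> G)}"
    unfolding succ_filter_def by (rule generated_filter_base(2)[OF sub ne dir])
  then show "succ_filter X \<F> =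
      {G. G \<subseteq> points X \<and> (\<exists>A\<in>\<F>. \<exists>\<epsilon>. \<epsilon> \<succ> 0 \<and> set_ball X \<epsilon> A \<subseteq> G)}"
    by (auto 0 4)
qed

lemma succ_filter_subset:
  fixes X :: "('a, 'v::value_quantale) space"
  assumes "(0::'v) \<noteq> top" "is_vspace X" and F: "is_filter_on (points X) \<F>"
  shows "succ_filter X \<F> \<subseteq> \<F>"
proof
  fix G
  assume "G \<in> succ_filter X \<F>"
  then obtain A \<epsilon> where "G \<subseteq> points X" "A \<in> \<F>" "set_ball X \<epsilon> A \<subseteq> G"
    by (auto simp: succ_filter_eq[OF assms(1) F])
  then show "G \<in> \<F>"
    using subset_set_ball[OF assms(2) filter_subsetD[OF F], of A \<epsilon>] filter_supersetD[OF F, of A G]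
    by blast
qed

lemma restricted_succ_filter:
  fixes X :: "('a, 'v::value_quantale) space"
  assumes "(0::'v) \<noteq> top" "is_vspace X" and F: "is_filter_on (points X) \<F>"
    and "restricted (X, \<F>)"
  shows "restricted (X, succ_filter X \<F>)"
proof -
  have "points X \<noteq> {} \<Longrightarrow> {} \<notin> \<F>"
    using assms(4) filter_improper_iff[OF F] by (simp add: restricted_def)
  then have "points X \<noteq> {} \<Longrightarrow> {} \<notin> succ_filter X \<F>"
    using succ_filter_subset[OF assms(1-3)] by (metis subsetD)
  then show ?thesis
    using filter_improper_iff[OF is_filter_on_succ_filter[OF assms(1) F]]
    by (simp add: restricted_def)
qed

text \<open>
  Let \<open>A \<in> \<F>\<close>, and let a \<open>\<gamma>\<close>-ball belong to \<open>\<F>\<^sub>\<succ>\<close>, hence to \<open>\<F>\<close>. As \<open>\<F>\<close> is proper, the ball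
  contains some \<open>y \<in> A\<close>, and going from \<open>y\<close> to the centre and on to any point of the ball
  costs at most \<open>\<epsilon>\<close> when \<open>\<gamma>\<close> is small. Hence the ball lies in the \<open>\<epsilon>\<close>-neighbourhood of \<open>A\<close>.
\<close>

lemma round_succ_filter:
  fixes X :: "('a, 'v::value_quantale) space"
  assumes nt: "(0::'v) \<noteq> top" and X: "is_vspace X" "uniformly_vanishing_asymmetry X"
    and F: "is_filter_on (points X) \<F>" and r: "restricted (X, \<F>)"
  shows "round_filter X (succ_filter X \<F>)"
  unfolding round_filter_def
proof
  fix G
  assume "G \<in> succ_filter X \<F>"
  then obtain A \<epsilon> where A: "A \<in> \<F>" "\<epsilon> \<succ> 0" "set_ball X \<epsilon> A \<subseteq> G"
    by (auto simp: succ_filter_eq[OF nt F])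
  obtain \<delta> where \<delta>: "\<delta> \<succ> 0" "\<delta> + \<delta> \<le> \<epsilon>"
    using well_above_zero_halving[OF A(2)] .
  obtain \<delta>' where \<delta>': "\<delta>' \<succ> 0"
    and asym: "\<And>x y. x \<in> points X \<Longrightarrow> y \<in> points X \<Longrightarrow>
      distance X (y, x) \<le> \<delta>' \<Longrightarrow> distance X (x, y) \<le> \<delta>"
    using X(2) \<delta>(1) unfolding uniformly_vanishing_asymmetry_def by blast
  have "pt_ball X (inf \<delta> \<delta>') x \<subseteq> G"
    if x: "x \<in> points X" and B: "pt_ball X (inf \<delta> \<delta>') x \<in> succ_filter X \<F>" for x
  proof
    fix z
    assume z: "z \<in> pt_ball X (inf \<delta> \<delta>') x"
    have "A \<inter> pt_ball X (inf \<delta> \<delta>') x \<in> \<F>"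
      using filter_IntD[OF F A(1)] B succ_filter_subset[OF nt X(1) F] by blast
    moreover have "{} \<notin> \<F>"
      using r x filter_improper_iff[OF F] by (auto simp: restricted_def)
    ultimately have "A \<inter> pt_ball X (inf \<delta> \<delta>') x \<noteq> {}"
      by metis
    then obtain y where y: "y \<in> A" "y \<in> pt_ball X (inf \<delta> \<delta>') x"
      by auto
    then have "x \<in> pt_ball X \<delta> y"
      using x asym by (auto simp: pt_ball_def)
    moreover have "z \<in> pt_ball X \<delta> x"
      using z by (auto simp: pt_ball_def)
    ultimately have "z \<in> pt_ball X \<epsilon> y"
      using set_ball_pt_ball_subset[OF X(1) _ \<delta>(2), of y] y(2)
      by (auto simp: set_ball_def pt_ball_def)
    with y(1) A(3) show "z \<in> G"
      by (auto simp: set_ball_def)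
  qed
  then show "\<exists>\<epsilon>. \<epsilon> \<succ> 0 \<and> (\<forall>x\<in>points X. pt_ball X \<epsilon> x \<in> succ_filter X \<F> \<longrightarrow> pt_ball X \<epsilon> x \<subseteq> G)"
    using inf_well_above_zero[OF \<delta>(1) \<delta>'] by blast
qed

lemma cauchy_succ_filter:
  fixes X :: "('a, 'v::value_quantale) space"
  assumes nt: "(0::'v) \<noteq> top" and X: "is_vspace X"
    and F: "is_filter_on (points X) \<F>" and c: "cauchy_filter X \<F>"
  shows "cauchy_filter X (succ_filter X \<F>)"
  unfolding cauchy_filter_def
proof (intro allI impI)
  fix \<epsilon> :: 'v
  assume "\<epsilon> \<succ> 0"
  then obtain \<delta> where \<delta>: "\<delta> \<succ> 0" "\<delta> + \<delta> \<le> \<epsilon>"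
    by (rule well_above_zero_halving)
  then obtain x where x: "x \<in> points X" "pt_ball X \<delta> x \<in> \<F>"
    using c unfolding cauchy_filter_def by blast
  have "pt_ball X \<epsilon> x \<subseteq> points X"
    by (auto simp: pt_ball_def)
  then have "pt_ball X \<epsilon> x \<in> succ_filter X \<F>"
    using x(2) \<delta>(1) set_ball_pt_ball_subset[OF X x(1) \<delta>(2)]
    by (auto simp: succ_filter_eq[OF nt F])
  then show "\<exists>x\<in>points X. pt_ball X \<epsilon> x \<in> succ_filter X \<F>"
    using x(1) by blast
qed

text \<open>
  The Cauchy property supplies a \<open>\<delta>\<close>-ball in the filter, and roundness places the concentric
  \<open>\<epsilon>\<close>-ball, which contains the \<open>\<delta>\<close>-neighbourhood of the \<open>\<delta>\<close>-ball, inside the given member.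
\<close>

lemma cauchy_round_subset_succ_filter:
  fixes X :: "('a, 'v::value_quantale) space"
  assumes nt: "(0::'v) \<noteq> top" and X: "is_vspace X"
    and F: "is_filter_on (points X) \<F>" and c: "cauchy_filter X \<F>" and r: "round_filter X \<F>"
  shows "\<F> \<subseteq> succ_filter X \<F>"
proof
  fix A
  assume A: "A \<in> \<F>"
  then obtain \<epsilon> where \<epsilon>: "\<epsilon> \<succ> 0"
    and sub: "\<And>x. x \<in> points X \<Longrightarrow> pt_ball X \<epsilon> x \<in> \<F> \<Longrightarrow> pt_ball X \<epsilon> x \<subseteq> A"
    using r unfolding round_filter_def by blast
  obtain \<delta> where \<delta>: "\<delta> \<succ> 0" "\<delta> + \<delta> \<le> \<epsilon>"
    using well_above_zero_halving[OF \<epsilon>] .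
  then obtain x where x: "x \<in> points X" "pt_ball X \<delta> x \<in> \<F>"
    using c unfolding cauchy_filter_def by blast
  note nbhd = set_ball_pt_ball_subset[OF X x(1) \<delta>(2)]
  have "pt_ball X \<delta> x \<subseteq> pt_ball X \<epsilon> x"
    using nbhd subset_set_ball[OF X filter_subsetD[OF F x(2)]] by blast
  then have "pt_ball X \<epsilon> x \<in> \<F>"
    by (rule filter_supersetD[OF F x(2)]) (auto simp: pt_ball_def)
  then have "set_ball X \<delta> (pt_ball X \<delta> x) \<subseteq> A"
    using nbhd sub[OF x(1)] by blast
  then show "A \<in> succ_filter X \<F>"
    using x(2) \<delta>(1) filter_subsetD[OF F A] by (auto simp: succ_filter_eq[OF nt F])
qed

section \<open>Categories of V-spaces with a filter\<close>

lemma Obj_Fil_iff: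
  "(X, \<F>) \<in> Obj Fil \<longleftrightarrow>
     is_vspace X \<and> uniformly_vanishing_asymmetry X \<and> is_filter_on (points X) \<F>"
  by (simp add: Fil_def)

lemma Hom_Fil_iff:
  "f \<in> Hom Fil (X, \<F>) (Y, \<G>) \<longleftrightarrow>
     f \<in> points X \<rightarrow>\<^sub>E points Y \<and> unif_continuous X Y f \<and>
     (\<forall>S\<in>\<G>. S \<subseteq> points Y \<and> f -` S \<inter> points X \<in> \<F>)"
  by (auto simp: Fil_def image_filter_def)

lemma Hom_Fil_PiE: "f \<in> Hom Fil A B \<Longrightarrow> f \<in> points (fst A) \<rightarrow>\<^sub>E points (fst B)"
  by (cases A; cases B) (simp add: Hom_Fil_iff)

lemma Hom_Fil_Pi: "f \<in> Hom Fil A B \<Longrightarrow> f \<in> points (fst A) \<rightarrow> points (fst B)"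
  using Hom_Fil_PiE[of f A B] by (simp add: PiE_def)

lemma Ident_Fil: "Ident Fil A = (\<lambda>x\<in>points (fst A). x)"
  by (cases A) (simp add: Fil_def)

lemma Comp_Fil: "Comp Fil A B C g f = compose (points (fst A)) g f"
  by (cases A; cases B; cases C) (simp add: Fil_def)

lemma unif_continuous_compose:
  assumes "unif_continuous X Y f" "unif_continuous Y Z g" "f \<in> points X \<rightarrow> points Y"
  shows "unif_continuous X Z (compose (points X) g f)"
  unfolding unif_continuous_def
proof (intro allI impI)
  fix \<epsilon> :: 'b
  assume "\<epsilon> \<succ> 0"
  then obtain \<delta> where "\<delta> \<succ> 0"
    and \<delta>: "\<forall>x\<in>points Y. \<forall>y\<in>points Y. distance Y (x, y) \<le> \<delta> \<longrightarrow> distance Z (g x, g y) \<le> \<epsilon>"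
    using assms(2) unfolding unif_continuous_def by blast
  then obtain \<gamma> where "\<gamma> \<succ> 0"
    and \<gamma>: "\<forall>x\<in>points X. \<forall>y\<in>points X. distance X (x, y) \<le> \<gamma> \<longrightarrow> distance Y (f x, f y) \<le> \<delta>"
    using assms(1) unfolding unif_continuous_def by blast
  with \<delta> assms(3) show "\<exists>\<gamma>. \<gamma> \<succ> 0 \<and> (\<forall>x\<in>points X. \<forall>y\<in>points X. distance X (x, y) \<le> \<gamma> \<longrightarrow>
      distance Z (compose (points X) g f x, compose (points X) g f y) \<le> \<epsilon>)"
    by (intro exI[of _ \<gamma>]) (auto simp: compose_def Pi_iff)
qed

lemma Ident_Fil_in_Hom:
  assumes "A \<in> Obj Fil"
  shows "Ident Fil A \<in> Hom Fil A A"
proof -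
  obtain X \<F> where A: "A = (X, \<F>)"
    by (cases A)
  then have sub: "S \<subseteq> points X" if "S \<in> \<F>" for S
    using assms that by (auto simp: Obj_Fil_iff dest: filter_subsetD)
  then have "(\<lambda>x\<in>points X. x) -` S \<inter> points X = S" if "S \<in> \<F>" for S
    using sub[OF that] by auto
  with sub show ?thesis
    by (auto simp: A Hom_Fil_iff Ident_Fil unif_continuous_def)
qed

lemma Comp_Fil_in_Hom:
  assumes f: "f \<in> Hom Fil A B" and g: "g \<in> Hom Fil B C"
  shows "Comp Fil A B C g f \<in> Hom Fil A C"
proof -
  obtain X \<F> Y \<G> Z \<H> where [simp]: "A = (X, \<F>)" "B = (Y, \<G>)" "C = (Z, \<H>)"
    by (cases A; cases B; cases C)
  have fX: "f \<in> points X \<rightarrow> points Y"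
    using Hom_Fil_Pi[OF f] by simp
  have "compose (points X) g f -` S \<inter> points X \<in> \<F>" if "S \<in> \<H>" for S
  proof -
    have "compose (points X) g f -` S \<inter> points X = f -` (g -` S \<inter> points Y) \<inter> points X"
      using fX by (auto simp: compose_def)
    moreover have "g -` S \<inter> points Y \<in> \<G>"
      using g that by (simp add: Hom_Fil_iff)
    then have "f -` (g -` S \<inter> points Y) \<inter> points X \<in> \<F>"
      using f by (simp add: Hom_Fil_iff del: vimage_Int)
    ultimately show ?thesis
      by (simp only:)
  qed
  moreover have "compose (points X) g f \<in> points X \<rightarrow>\<^sub>E points Z"
    using fX Hom_Fil_Pi[OF g] by (auto simp: compose_def)
  moreover have "unif_continuous X Z (compose (points X) g f)"
    using f g fX by (auto simp: Hom_Fil_iff intro: unif_continuous_compose)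
  ultimately show ?thesis
    using g by (auto simp: Hom_Fil_iff Comp_Fil)
qed

lemma Comp_Fil_assoc:
  assumes "f \<in> Hom Fil A B"
  shows "Comp Fil A C D h (Comp Fil A B C g f) = Comp Fil A B D (Comp Fil B C D h g) f"
  unfolding Comp_Fil by (rule compose_assoc[OF Hom_Fil_Pi[OF assms]])

lemma Comp_Fil_Ident:
  assumes "f \<in> Hom Fil A B"
  shows "Comp Fil A A B f (Ident Fil A) = f" "Comp Fil A B B (Ident Fil B) f = f"
  using Hom_Fil_PiE[OF assms] by (auto simp: Comp_Fil Ident_Fil PiE_def compose_Id Id_compose)

lemma is_category_Fil: "is_category Fil"
  unfolding is_category_def
  by (intro conjI ballI Ident_Fil_in_Hom Comp_Fil_in_Hom Comp_Fil_assoc Comp_Fil_Ident)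

lemma full_subcategory_simps:
  "Obj (full_subcategory \<C> P) = {A \<in> Obj \<C>. P A}"
  "Hom (full_subcategory \<C> P) = Hom \<C>"
  "Ident (full_subcategory \<C> P) = Ident \<C>"
  "Comp (full_subcategory \<C> P) = Comp \<C>"
  by (simp_all add: full_subcategory_def)

lemma is_category_full_subcategory:
  assumes "is_category \<C>"
  shows "is_category (full_subcategory \<C> P)"
  using assms unfolding is_category_def full_subcategory_simps by auto

lemma is_functor_inclusion:
  assumes "is_category \<C>" and "\<And>A. A \<in> Obj \<C> \<Longrightarrow> P A \<Longrightarrow> Q A"
  shows "is_functor (full_subcategory \<C> P) (full_subcategory \<C> Q) inclusion_functor"
  using assms is_category_full_subcategory[OF assms(1)]
  by (auto simp: is_functor_def inclusion_functor_def full_subcategory_simps)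

section \<open>Functoriality and adjointness\<close>

text \<open>
  If \<open>\<delta>\<close> witnesses uniform continuity of \<open>f\<close> at \<open>\<epsilon>\<close>, then \<open>f\<close> maps the \<open>\<delta>\<close>-neighbourhood of the
  preimage of \<open>B\<close> into the \<open>\<epsilon>\<close>-neighbourhood of \<open>B\<close>.
\<close>

lemma Hom_Fil_succ_filter:
  fixes X Y :: "('a, 'v::value_quantale) space"
  assumes nt: "(0::'v) \<noteq> top"
    and F: "is_filter_on (points X) \<F>" and G: "is_filter_on (points Y) \<G>"
    and f: "f \<in> Hom Fil (X, \<F>) (Y, \<G>)"
  shows "f \<in> Hom Fil (X, succ_filter X \<F>) (Y, succ_filter Y \<G>)"
proof -
  have fX: "f \<in> points X \<rightarrow> points Y"
    using f by (auto simp: Hom_Fil_iff)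
  have "f -` S \<inter> points X \<in> succ_filter X \<F>" if "S \<in> succ_filter Y \<G>" for S
  proof -
    from that obtain B \<epsilon> where B: "B \<in> \<G>" "\<epsilon> \<succ> 0" "set_ball Y \<epsilon> B \<subseteq> S"
      by (auto simp: succ_filter_eq[OF nt G])
    then obtain \<delta> where \<delta>: "\<delta> \<succ> 0"
      "\<forall>x\<in>points X. \<forall>y\<in>points X. distance X (x, y) \<le> \<delta> \<longrightarrow> distance Y (f x, f y) \<le> \<epsilon>"
      using f unfolding Hom_Fil_iff unif_continuous_def by blast
    have "set_ball X \<delta> (f -` B \<inter> points X) \<subseteq> f -` set_ball Y \<epsilon> B"
      using \<delta>(2) fX by (fastforce simp: set_ball_iff)
    then have "set_ball X \<delta> (f -` B \<inter> points X) \<subseteq> f -` S \<inter> points X"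
      using B(3) set_ball_subset_points[of X] by blast
    moreover have "f -` B \<inter> points X \<in> \<F>"
      using f B(1) by (auto simp: Hom_Fil_iff)
    ultimately show ?thesis
      using \<delta>(1) by (auto simp: succ_filter_eq[OF nt F])
  qed
  moreover have "S \<subseteq> points Y" if "S \<in> succ_filter Y \<G>" for S
    using that by (auto simp: succ_filter_eq[OF nt G])
  ultimately show ?thesis
    using f by (auto simp: Hom_Fil_iff)
qed

lemma Hom_Fil_succ_filter_eq:
  fixes X Y :: "('a, 'v::value_quantale) space"
  assumes nt: "(0::'v) \<noteq> top" and X: "(X, \<F>) \<in> Obj Fil" and Y: "(Y, \<G>) \<in> Obj Fil"
    and "cauchy_filter Y \<G>" "round_filter Y \<G>"
  shows "Hom Fil (X, succ_filter X \<F>) (Y, \<G>) = Hom Fil (X, \<F>) (Y, \<G>)"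
proof -
  have "succ_filter X \<F> \<subseteq> \<F>"
    using X by (simp add: Obj_Fil_iff succ_filter_subset[OF nt])
  moreover have "\<G> \<subseteq> succ_filter Y \<G>"
    using Y assms(4,5) by (simp add: Obj_Fil_iff cauchy_round_subset_succ_filter[OF nt])
  moreover have "f \<in> Hom Fil (X, succ_filter X \<F>) (Y, succ_filter Y \<G>)"
    if "f \<in> Hom Fil (X, \<F>) (Y, \<G>)" for f
    using Hom_Fil_succ_filter[OF nt _ _ that] X Y by (simp add: Obj_Fil_iff)
  ultimately show ?thesis
    unfolding set_eq_iff Hom_Fil_iff by blast
qed

lemma is_functor_succ_functor:
  fixes P Q :: "('a, 'v::value_quantale) fil_obj \<Rightarrow> bool"
  assumes nt: "(0::'v) \<noteq> top"
    and PQ: "\<And>X \<F>. (X, \<F>) \<in> Obj Fil \<Longrightarrow> P (X, \<F>) \<Longrightarrow> Q (X, succ_filter X \<F>)"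
  shows "is_functor (full_subcategory Fil P) (full_subcategory Fil Q) succ_functor"
proof -
  have "(X, succ_filter X \<F>) \<in> Obj Fil" if "(X, \<F>) \<in> Obj Fil"
    for X :: "('a, 'v) space" and \<F>
    using that by (simp add: Obj_Fil_iff is_filter_on_succ_filter[OF nt])
  moreover have "f \<in> Hom Fil (X, succ_filter X \<F>) (Y, succ_filter Y \<G>)"
    if "(X, \<F>) \<in> Obj Fil" "(Y, \<G>) \<in> Obj Fil" "f \<in> Hom Fil (X, \<F>) (Y, \<G>)"
    for X Y :: "('a, 'v) space" and f \<F> \<G>
    using that by (simp add: Obj_Fil_iff Hom_Fil_succ_filter[OF nt])
  ultimately show ?thesis
    using PQ is_category_full_subcategory[OF is_category_Fil]
    by (auto simp: is_functor_def full_subcategory_simps succ_functor_def Ident_Fil Comp_Fil)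
qed

theorem proposition4p10:
  assumes nontrivial: "(0::'v::value_quantale) \<noteq> top"
  shows "is_functor (rFil :: ('a, 'v) fil_cat) rRFil succ_functor \<and>
         is_functor (rCFil :: ('a, 'v) fil_cat) rCRFil succ_functor \<and>
         is_left_adjoint (rCFil :: ('a, 'v) fil_cat) rCRFil succ_functor inclusion_functor"
proof (intro conjI)
  show "is_functor (rFil :: ('a, 'v) fil_cat) rRFil succ_functor"
    unfolding rFil_def rRFil_def
    by (rule is_functor_succ_functor[OF nontrivial])
      (auto simp: Obj_Fil_iff intro: restricted_succ_filter[OF nontrivial]
        round_succ_filter[OF nontrivial])
  show F: "is_functor (rCFil :: ('a, 'v) fil_cat) rCRFil succ_functor"
    unfolding rCFil_def rCRFil_def
    by (rule is_functor_succ_functor[OF nontrivial])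
      (auto simp: Obj_Fil_iff
        intro: restricted_succ_filter[OF nontrivial]
        cauchy_succ_filter[OF nontrivial] round_succ_filter[OF nontrivial])
  have G: "is_functor (rCRFil :: ('a, 'v) fil_cat) rCFil inclusion_functor"
    unfolding rCFil_def rCRFil_def
    by (rule is_functor_inclusion[OF is_category_Fil]) auto
  show "is_left_adjoint (rCFil :: ('a, 'v) fil_cat) rCRFil succ_functor inclusion_functor"
    unfolding is_left_adjoint_def
  proof (intro conjI F G)
    (* The two hom-sets coincide, so the identity serves as the bijection, and naturality is
       associativity of composition. *)
    have "Hom Fil (X, succ_filter X \<F>) (Y, \<G>) = Hom Fil (X, \<F>) (Y, \<G>)"
      if "(X, \<F>) \<in> Obj rCFil" "(Y, \<G>) \<in> Obj rCRFil"
      for X Y :: "('a, 'v) space" and \<F> \<G>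
      using that
      by (simp add: rCFil_def rCRFil_def full_subcategory_simps Hom_Fil_succ_filter_eq[OF nontrivial])
    then show "\<exists>\<phi>.
        (\<forall>A\<in>Obj (rCFil :: ('a, 'v) fil_cat). \<forall>B\<in>Obj (rCRFil :: ('a, 'v) fil_cat).
           bij_betw (\<phi> A B) (Hom rCRFil (onObj succ_functor A) B)
             (Hom rCFil A (onObj inclusion_functor B))) \<and>
        (\<forall>A\<in>Obj rCFil. \<forall>A'\<in>Obj rCFil. \<forall>B\<in>Obj rCRFil. \<forall>B'\<in>Obj rCRFil.
           \<forall>h\<in>Hom rCFil A' A. \<forall>k\<in>Hom rCRFil B B'. \<forall>g\<in>Hom rCRFil (onObj succ_functor A) B.
           \<phi> A' B' (Comp rCRFil (onObj succ_functor A') B B' k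
                       (Comp rCRFil (onObj succ_functor A') (onObj succ_functor A) B g
                          (onArr succ_functor A' A h))) =
           Comp rCFil A' (onObj inclusion_functor B) (onObj inclusion_functor B')
             (onArr inclusion_functor B B' k)
             (Comp rCFil A' A (onObj inclusion_functor B) (\<phi> A B g) h))"
      by (intro exI[of _ "\<lambda>A B f. f"])
        (auto simp: rCFil_def rCRFil_def full_subcategory_simps succ_functor_def
          inclusion_functor_def Comp_Fil bij_betw_def intro!: compose_assoc dest: Hom_Fil_Pi)
  qed
qed

end
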